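(* Let $\{(b_i,d_i)\}_{i=1}^N$ be a persistence diagram, $K\ge1$ an integer, $M\subset\mathbb{R}$ a finite set, and let $f:\mathbb{R}^{K\times|M|}\to\mathbb{R}$ be $L_f$-Lipschitz with respect to the $1$-norm, i.e. $|f(x)-f(y)|\le L_f\|x-y\|_1$. For each player $i$ put $R_i=L_f\|\ell_i\|_1$, where $\|\ell_i\|_1=\sum_{m\in M}\ell_i(m)$. Let $\hat\varphi_i(v_f)$ be the Monte Carlo permutation estimate of $\varphi_i(v_f)$ from $n\ge 1$ i.i.d. uniformly sampled permutations. Then: (1) For every fixed player $i$, every $\varepsilon>0$ and every $\delta\in(0,1)$, \[n\ge\frac{2R_i^2}{\varepsilon^2}\log\frac2\delta\ \Longrightarrow\ \Pr\bigl(|\hat\varphi_i(v_f)-\varphi_i(v_f)|\ge\varepsilon\bigr)<\delta.\] (2) Let $R_{\max}=\max_iR_i$. For every $\varepsilon>0$ and $\delta\in(0,1)$, if $n\ge\frac{2R_{\max}^2}{\varepsilon^2}\log\frac{2N}{\delta}$ (so $n=O(R_{\max}^2\varepsilon^{-2}\log(N/\delta))$ samples suffice), then the guarantee holds simultaneously for all $N$ players: \[\Pr\bigl(\exists\, i\in\{1,\dots,N\}:\ |\hat\varphi_i(v_f)-\varphi_i(v_f)|\ge\varepsilon\bigr)<\delta.\]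
   Context: A persistence diagram here is a finite indexed family of points $(b_i,d_i)\in\mathbb{R}^2$ with $b_i\le d_i$, $i=1,\dots,N$, $N\ge1$. The tent function of point $i$ is $\ell_i(m)=\min(\max(0,m-b_i),\max(0,d_i-m))$. For a coalition $S\subset\{1,\dots,N\}$, $\Lambda(S)\in\mathbb{R}^{K\times|M|}$ is the discretized persistence landscape of the points in $S$: $\Lambda(S)_{(k,m)}$ is the $k$-th largest value (with multiplicity) among $\{\ell_i(m):i\in S\}$ if $|S|\ge k$, and $0$ if $|S|<k$, for $k\in\{1,\dots,K\}$, $m\in M$. The game of $f$ is $v_f(S)=f(\Lambda(S))$. For a permutation $\pi$ of $\{1,\dots,N\}$ let $P_i^\pi=\{j:\pi(j)<\pi(i)\}$. The Shapley value is $\varphi_i(v_f)=\frac1{N!}\sum_{\pi}(v_f(P_i^\pi\cup\{i\})-v_f(P_i^\pi))$, the sum being over all permutations $\pi$ of $\{1,\dots,N\}$. The Monte Carlo estimator draws $\pi_1,\dots,\pi_n$ i.i.d. uniformly from all permutations of $\{1,\dots,N\}$ and sets, for every $i$ (using the same permutations), $\hat\varphi_i(v_f)=\frac1n\sum_{s=1}^n\bigl(v_f(P_i^{\pi_s}\cup\{i\})-v_f(P_i^{\pi_s})\bigr)$. *)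

theory Defs
  imports "HOL-Probability.Probability" "HOL-Combinatorics.Permutations"
    "HOL-Library.Multiset" "HOL-Library.Landau_Symbols"
begin

text \<open>
  A persistence diagram of size \<open>N\<close> is a pair of families \<open>b\<close>, \<open>d\<close> on the index set \<open>{1..N}\<close>
  with \<open>b i \<le> d i\<close> there; values outside \<open>{1..N}\<close> are irrelevant.
\<close>

definition persistence_diagram :: "nat \<Rightarrow> (nat \<Rightarrow> real) \<Rightarrow> (nat \<Rightarrow> real) \<Rightarrow> bool" where
  "persistence_diagram N b d \<longleftrightarrow> N \<ge> 1 \<and> (\<forall>i\<in>{1..N}. b i \<le> d i)"

definition tent :: "(nat \<Rightarrow> real) \<Rightarrow> (nat \<Rightarrow> real) \<Rightarrow> nat \<Rightarrow> real \<Rightarrow> real" where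
  "tent b d i m = min (max 0 (m - b i)) (max 0 (d i - m))"

definition tent_norm1 :: "(nat \<Rightarrow> real) \<Rightarrow> (nat \<Rightarrow> real) \<Rightarrow> real set \<Rightarrow> nat \<Rightarrow> real" where
  "tent_norm1 b d M i = (\<Sum>m\<in>M. tent b d i m)"

text \<open>
  The space of real arrays with rows \<open>1, \<dots>, K\<close> and one column per point of the finite set \<open>M\<close>,
  represented by extensional functions on \<open>{1..K} \<times> M\<close>.
\<close>

definition arrays :: "nat \<Rightarrow> real set \<Rightarrow> (nat \<times> real \<Rightarrow> real) set" where
  "arrays K M = {1..K} \<times> M \<rightarrow>\<^sub>E UNIV"

definition dist1 :: "nat \<Rightarrow> real set \<Rightarrow> (nat \<times> real \<Rightarrow> real) \<Rightarrow> (nat \<times> real \<Rightarrow> real) \<Rightarrow> real" where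
  "dist1 K M x y = (\<Sum>p\<in>{1..K} \<times> M. \<bar>x p - y p\<bar>)"

definition lipschitz1 :: "nat \<Rightarrow> real set \<Rightarrow> real \<Rightarrow> ((nat \<times> real \<Rightarrow> real) \<Rightarrow> real) \<Rightarrow> bool" where
  "lipschitz1 K M L f \<longleftrightarrow>
     (\<forall>x\<in>arrays K M. \<forall>y\<in>arrays K M. \<bar>f x - f y\<bar> \<le> L * dist1 K M x y)"

text \<open>The \<open>k\<close>-th largest member of a multiset of size at least \<open>k \<ge> 1\<close>, with multiplicity.\<close>

definition kth_largest :: "nat \<Rightarrow> real multiset \<Rightarrow> real" where
  "kth_largest k A = rev (sorted_list_of_multiset A) ! (k - 1)"

definition landscape ::
    "(nat \<Rightarrow> real) \<Rightarrow> (nat \<Rightarrow> real) \<Rightarrow> nat \<Rightarrow> real set \<Rightarrow> nat set \<Rightarrow> (nat \<times> real \<Rightarrow> real)" where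
  "landscape b d K M S = (\<lambda>(k, m)\<in>{1..K} \<times> M.
     if card S \<ge> k then kth_largest k (image_mset (\<lambda>i. tent b d i m) (mset_set S)) else 0)"

definition landscape_game ::
    "(nat \<Rightarrow> real) \<Rightarrow> (nat \<Rightarrow> real) \<Rightarrow> nat \<Rightarrow> real set \<Rightarrow> ((nat \<times> real \<Rightarrow> real) \<Rightarrow> real) \<Rightarrow>
     nat set \<Rightarrow> real" where
  "landscape_game b d K M f S = f (landscape b d K M S)"

definition predecessors :: "nat \<Rightarrow> (nat \<Rightarrow> nat) \<Rightarrow> nat \<Rightarrow> nat set" where
  "predecessors N \<pi> i = {j\<in>{1..N}. \<pi> j < \<pi> i}"

definition marginal :: "nat \<Rightarrow> (nat set \<Rightarrow> real) \<Rightarrow> (nat \<Rightarrow> nat) \<Rightarrow> nat \<Rightarrow> real" where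
  "marginal N v \<pi> i = v (predecessors N \<pi> i \<union> {i}) - v (predecessors N \<pi> i)"

definition shapley :: "nat \<Rightarrow> (nat set \<Rightarrow> real) \<Rightarrow> nat \<Rightarrow> real" where
  "shapley N v i = 1 / fact N * (\<Sum>\<pi> | \<pi> permutes {1..N}. marginal N v \<pi> i)"

text \<open>The estimate from the sampled permutations \<open>\<sigma> 1, \<dots>, \<sigma> n\<close>.\<close>

definition mc_shapley ::
    "nat \<Rightarrow> (nat set \<Rightarrow> real) \<Rightarrow> nat \<Rightarrow> (nat \<Rightarrow> nat \<Rightarrow> nat) \<Rightarrow> nat \<Rightarrow> real" where
  "mc_shapley N v n \<sigma> i = 1 / real n * (\<Sum>s=1..n. marginal N v (\<sigma> s) i)"

definition iid_uniform_perms ::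
    "'a measure \<Rightarrow> nat \<Rightarrow> nat \<Rightarrow> (nat \<Rightarrow> 'a \<Rightarrow> nat \<Rightarrow> nat) \<Rightarrow> bool" where
  "iid_uniform_perms P N n X \<longleftrightarrow> prob_space P \<and>
     prob_space.indep_vars P (\<lambda>_. count_space UNIV) X {1..n} \<and>
     (\<forall>s\<in>{1..n}. distr P (count_space UNIV) (X s) =
        measure_pmf (pmf_of_set {\<pi>. \<pi> permutes {1..N}}))"

text \<open>
  The regime in which the order of the sample size is measured: \<open>N / \<delta>\<close> tends to infinity, uniformly
  in \<open>R\<close> and \<open>\<epsilon>\<close>. Some such restriction is needed, since for \<open>N = 1\<close> and \<open>\<delta>\<close> near 1 the
  quantity \<open>ln (N / \<delta>)\<close> vanishes but \<open>ln (2 * N / \<delta>)\<close> does not.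
\<close>

definition sample_regime :: "(real \<times> real \<times> real \<times> nat) filter" where
  "sample_regime =
     inf (filtercomap (\<lambda>(R, \<epsilon>, \<delta>, N). real N / \<delta>) at_top)
         (principal {(R, \<epsilon>, \<delta>, N). R \<ge> 0 \<and> \<epsilon> > 0 \<and> 0 < \<delta> \<and> \<delta> < 1 \<and> N \<ge> 1})"

end

theory Submission
  imports Defs
begin

text \<open>
  Inserting a value \<open>x \<ge> 0\<close> into a decreasing list of nonnegative numbers pushes the entries below
  \<open>x\<close> one place to the right; the resulting differences telescope to at most \<open>x\<close>. So the marginal
  contributions of player \<open>i\<close> lie in an interval of length \<open>2 * R i\<close>, and Hoeffding's inequality
  followed by a union bound gives the estimate with \<open>\<le>\<close>. The strict inequality comes from
  Markov's inequality for the exponential moment, which is strict because the centered sum has mean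
  \<open>0\<close> and therefore falls below \<open>\<epsilon>\<close> with positive probability.
\<close>

section \<open>Landscapes under insertion of a point\<close>

text \<open>Padding with 0 keeps a decreasing nonnegative list decreasing beyond its end, so the
  differences of neighbours are nonnegative and telescope for every \<open>K\<close>, whether or not
  it exceeds the length. The induction peels off \<open>x - y\<close> and leaves at most
  \<open>y\<close> for the tail.\<close>

lemma sum_nth_default_Cons_diff:
  fixes x :: real
  assumes "sorted_wrt (\<ge>) (x # xs)" "\<forall>y\<in>set (x # xs). y \<ge> 0"
  shows "(\<Sum>k<K. \<bar>nth_default 0 (x # xs) k - nth_default 0 xs k\<bar>) \<le> x"
  using assms
proof (induction xs arbitrary: x K)
  case Nil
  have "(\<Sum>k<K. \<bar>nth_default 0 [x] k - nth_default 0 [] k\<bar>) = (\<Sum>k<K. if k = 0 then x else 0)"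
    using Nil by (intro sum.cong) (auto simp: nth_default_def)
  also have "\<dots> \<le> x" using Nil by simp
  finally show ?case .
next
  case (Cons y ys)
  show ?case
  proof (cases K)
    case 0
    then show ?thesis using Cons.prems by simp
  next
    case (Suc K')
    have "(\<Sum>k<K'. \<bar>nth_default 0 (y # ys) k - nth_default 0 ys k\<bar>) \<le> y"
      using Cons.prems by (intro Cons.IH) auto
    then show ?thesis
      using Cons.prems by (simp add: Suc sum.lessThan_Suc_shift del: sum.lessThan_Suc)
  qed
qed

text \<open>Entries above \<open>x\<close> stand at the same positions in both lists and contribute
  0. From the place of insertion on, the two lists are \<open>x # ys\<close> and \<open>ys\<close>,
  which is the previous lemma.\<close>

lemma sum_nth_default_insort_diff:
  fixes x :: real
  assumes "sorted_wrt (\<ge>) xs" "\<forall>y\<in>set xs. y \<ge> 0" "x \<ge> 0"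
  shows "(\<Sum>k<K. \<bar>nth_default 0 (insort_key uminus x xs) k - nth_default 0 xs k\<bar>) \<le> x"
  using assms
proof (induction xs arbitrary: K)
  case Nil
  then show ?case using sum_nth_default_Cons_diff[of x "[]" K] by simp
next
  case (Cons y ys)
  show ?case
  proof (cases "y \<le> x")
    case True
    then have "sorted_wrt (\<ge>) (x # y # ys)"
      using Cons.prems by (auto intro: order_trans)
    then show ?thesis
      using True sum_nth_default_Cons_diff[of x "y # ys" K] Cons.prems by simp
  next
    case False
    show ?thesis
    proof (cases K)
      case 0
      then show ?thesis using Cons.prems by simp
    next
      case (Suc K')
      then show ?thesis
        using False Cons by (simp add: sum.lessThan_Suc_shift del: sum.lessThan_Suc)
    qed
  qed
qed

lemma sorted_wrt_rev_sorted_list_of_multiset: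
  "sorted_wrt (\<ge>) (rev (sorted_list_of_multiset A))"
  by (simp add: sorted_wrt_rev)

lemma rev_sorted_list_of_multiset_add:
  fixes x :: real
  shows "rev (sorted_list_of_multiset (add_mset x A)) =
    insort_key uminus x (rev (sorted_list_of_multiset A))"
proof -
  define xs where "xs = rev (sorted_list_of_multiset A)"
  \<comment> \<open>Negation turns decreasing order into increasing order, which is why the key
    \<open>uminus\<close> makes \<open>insort_key\<close> insert into a decreasing list.\<close>
  have *: "sorted_wrt (\<ge>) ys \<longleftrightarrow> sorted (map uminus ys)" for ys :: "real list"
    by (simp add: sorted_wrt_map)
  have "sorted_wrt (\<ge>) (insort_key uminus x xs)"
    using sorted_wrt_rev_sorted_list_of_multiset[of A]
    unfolding * sorted_insort_key xs_def .
  then have "sorted (rev (insort_key uminus x xs))"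
    by (simp add: sorted_wrt_rev)
  moreover have "mset (insort_key uminus x ys) = add_mset x (mset ys)" for ys
    by (induction ys) auto
  then have "mset (rev (insort_key uminus x xs)) = add_mset x A"
    by (simp add: xs_def)
  ultimately have "sorted_list_of_multiset (add_mset x A) = rev (insort_key uminus x xs)"
    by (metis sorted_list_of_multiset_mset sorted_sort_id)
  then show ?thesis by (simp add: xs_def)
qed

lemma tent_nonneg: "tent b d i m \<ge> 0"
  by (simp add: tent_def)

lemma landscape_in_arrays: "landscape b d K M S \<in> arrays K M"
  unfolding landscape_def arrays_def by auto

text \<open>The default 0 absorbs the case \<open>card S < k\<close> of the landscape, so no case
  distinction on the size of the coalition remains. Ranks start at 1 and list positions at 0, hence
  \<open>k - 1\<close>.\<close>

lemma landscape_eq_nth_default: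
  assumes "k \<in> {1..K}" "m \<in> M" "finite S"
  shows "landscape b d K M S (k, m) = nth_default 0
    (rev (sorted_list_of_multiset (image_mset (\<lambda>i. tent b d i m) (mset_set S)))) (k - 1)"
proof -
  have "length (sorted_list_of_multiset A) = size A" for A :: "real multiset"
    by (metis mset_sorted_list_of_multiset size_mset)
  then show ?thesis
    using assms by (auto simp: landscape_def nth_default_def kth_largest_def)
qed

text \<open>In each column \<open>m\<close> the new player inserts the single value
  \<open>tent b d i m\<close> into the decreasing list of tent values, which costs at most that
  value; the columns are then added up.\<close>

lemma dist1_landscape_insert:
  assumes "finite S" "i \<notin> S" "finite M"
  shows "dist1 K M (landscape b d K M (insert i S)) (landscape b d K M S) \<le> tent_norm1 b d M i"
proof -
  let ?A = "\<lambda>m. image_mset (\<lambda>i. tent b d i m) (mset_set S)"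
  let ?xs = "\<lambda>m. rev (sorted_list_of_multiset (?A m))"
  have col: "(\<Sum>k\<in>{1..K}. \<bar>landscape b d K M (insert i S) (k, m) - landscape b d K M S (k, m)\<bar>)
      \<le> tent b d i m" if "m \<in> M" for m
  proof -
    have "(\<Sum>k\<in>{1..K}. \<bar>landscape b d K M (insert i S) (k, m) - landscape b d K M S (k, m)\<bar>)
      = (\<Sum>k\<in>{1..K}. \<bar>nth_default 0 (insort_key uminus (tent b d i m) (?xs m)) (k - 1)
            - nth_default 0 (?xs m) (k - 1)\<bar>)"
      using assms that
      by (intro sum.cong)
        (simp_all add: landscape_eq_nth_default flip: rev_sorted_list_of_multiset_add)
    also have "\<dots> = (\<Sum>k<K. \<bar>nth_default 0 (insort_key uminus (tent b d i m) (?xs m)) k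
            - nth_default 0 (?xs m) k\<bar>)"
      by (rule sum.reindex_bij_witness[of _ Suc "\<lambda>k. k - 1"]) auto
    also have "\<dots> \<le> tent b d i m"
      using assms
      by (intro sum_nth_default_insort_diff sorted_wrt_rev_sorted_list_of_multiset)
        (auto simp: tent_nonneg)
    finally show ?thesis .
  qed
  have "dist1 K M (landscape b d K M (insert i S)) (landscape b d K M S) =
    (\<Sum>m\<in>M. \<Sum>k\<in>{1..K}. \<bar>landscape b d K M (insert i S) (k, m) - landscape b d K M S (k, m)\<bar>)"
    unfolding dist1_def by (subst sum.swap) (simp add: sum.cartesian_product)
  also have "\<dots> \<le> tent_norm1 b d M i"
    unfolding tent_norm1_def by (intro sum_mono col)
  finally show ?thesis .
qed

text \<open>The constant arrays 0 and 1 have the positive distance \<open>K * card M\<close>, which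
  a negative constant would turn into a negative bound for an absolute value.\<close>

lemma lipschitz1_nonneg:
  assumes "lipschitz1 K M L f" "K \<ge> 1" "finite M" "M \<noteq> {}"
  shows "L \<ge> 0"
proof -
  obtain m where m: "m \<in> M" using assms by blast
  let ?x = "\<lambda>p\<in>{1..K} \<times> M. 0 :: real" and ?y = "\<lambda>p\<in>{1..K} \<times> M. 1 :: real"
  have "0 \<le> \<bar>f ?x - f ?y\<bar>" by simp
  also have "\<dots> \<le> L * dist1 K M ?x ?y"
    using assms by (auto simp: lipschitz1_def arrays_def)
  also have "dist1 K M ?x ?y = real (K * card M)"
    by (simp add: dist1_def card_cartesian_product)
  finally have "0 \<le> L * real (K * card M)" .
  moreover have "real (K * card M) > 0"
    using assms by (simp add: card_gt_0_iff)
  ultimately show ?thesis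
    by (simp only: zero_le_mult_iff) linarith
qed

text \<open>A player is never among its own predecessors, since the comparison is strict. So a
  marginal contribution compares two landscapes that differ by the insertion of one point.\<close>

lemma abs_marginal_landscape_game_le:
  assumes "lipschitz1 K M L f" "K \<ge> 1" "finite M"
  shows "\<bar>marginal N (landscape_game b d K M f) \<pi> i\<bar> \<le> L * tent_norm1 b d M i"
proof -
  define S where "S = predecessors N \<pi> i"
  have S: "finite S" "i \<notin> S" by (auto simp: S_def predecessors_def)
  have "\<bar>marginal N (landscape_game b d K M f) \<pi> i\<bar> =
      \<bar>f (landscape b d K M (insert i S)) - f (landscape b d K M S)\<bar>"
    by (simp add: marginal_def landscape_game_def S_def)
  also have "\<dots> \<le> L * dist1 K M (landscape b d K M (insert i S)) (landscape b d K M S)"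
    using assms landscape_in_arrays by (auto simp: lipschitz1_def)
  also have "\<dots> \<le> L * tent_norm1 b d M i"
  \<comment> \<open>Over an empty grid \<open>L\<close> may be negative, so multiplying an
    inequality by it is not allowed; but both sides are 0 then.\<close>
  proof (cases "M = {}")
    case True
    then show ?thesis by (simp add: dist1_def tent_norm1_def)
  next
    case False
    then show ?thesis
      using assms S by (intro mult_left_mono dist1_landscape_insert lipschitz1_nonneg) auto
  qed
  finally show ?thesis .
qed

section \<open>A strict form of Hoeffding's inequality\<close>

lemma (in Hoeffding_ineq) Hoeffding_ineq_ge_strict:
  assumes "\<epsilon> > 0" and "(\<Sum>i\<in>I. (b i - a i)\<^sup>2) > 0"
  shows "prob {x\<in>space M. (\<Sum>i\<in>I. X i x) \<ge> \<mu> + \<epsilon>} < exp (-2 * \<epsilon>\<^sup>2 / (\<Sum>i\<in>I. (b i - a i)\<^sup>2))"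
proof -
  define D where "D = (\<Sum>i\<in>I. (b i - a i)\<^sup>2)"
  \<comment> \<open>This \<open>l\<close> minimizes the exponent
    \<open>l\<^sup>2 * D / 8 - l * \<epsilon>\<close> of the Chernoff bound; the minimum is
    \<open>-2 * \<epsilon>\<^sup>2 / D\<close>.\<close>
  define l where "l = 4 * \<epsilon> / D"
  define Y where "Y = (\<lambda>i x. exp (l * (X i x - expectation (X i))))"
  define A where "A = {x\<in>space M. (\<Sum>i\<in>I. X i x) \<ge> \<mu> + \<epsilon>}"
  have D: "D > 0" using assms by (simp add: D_def)
  then have l: "l > 0" using assms by (simp add: l_def)
  have A [measurable]: "A \<in> sets M" unfolding A_def by measurable
  have int_X: "integrable M (X i)" if "i \<in> I" for i
  proof -
    interpret interval_bounded_random_variable M "X i" "a i" "b i" using that ..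
    show ?thesis by (rule integrable)
  qed
  have Y: "integrable M (Y i) \<and> expectation (Y i) \<le> exp (l\<^sup>2 * (b i - a i)\<^sup>2 / 8)"
    if "i \<in> I" for i
  proof -
    interpret interval_bounded_random_variable M "X i" "a i" "b i" using that ..
    \<comment> \<open>Stated for the nonnegative integral, Hoeffding's lemma yields both the
      integrability of \<open>Y i\<close> and the bound on its expectation.\<close>
    have *: "(\<integral>\<^sup>+x. ennreal (Y i x) \<partial>M) \<le> ennreal (exp (l\<^sup>2 * (b i - a i)\<^sup>2 / 8))"
      unfolding Y_def by (rule Hoeffdings_lemma_nn_integral[OF l])
    have "Y i \<in> borel_measurable M" unfolding Y_def by measurable
    moreover have "(\<integral>\<^sup>+x. ennreal (Y i x) \<partial>M) < \<infinity>"
      using * by (rule order.strict_trans1) simp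
    ultimately have "integrable M (Y i)"
      by (intro integrableI_nonneg) (auto simp: Y_def)
    moreover have "expectation (Y i) \<le> exp (l\<^sup>2 * (b i - a i)\<^sup>2 / 8)"
      by (rule integral_real_bounded[OF _ *]) simp
    ultimately show ?thesis by simp
  qed
  have indep_Y: "indep_vars (\<lambda>_. borel) Y I"
    unfolding Y_def by (rule indep_vars_compose2[OF indep]) simp
  have prod_Y: "(\<Prod>i\<in>I. Y i x) = exp (l * ((\<Sum>i\<in>I. X i x) - \<mu>))" for x
    by (simp add: Y_def \<mu>_def fin flip: exp_sum sum_distrib_left sum_subtractf)
  have int_Y: "integrable M (\<lambda>x. \<Prod>i\<in>I. Y i x)"
    using Y by (intro indep_vars_integrable fin indep_Y) auto
  \<comment> \<open>If the sum were almost surely at least \<open>\<mu> + \<epsilon>\<close>, so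
    would be its mean, which is \<open>\<mu>\<close>.\<close>
  have not_AE: "\<not> (AE x in M. x \<in> A)"
  proof
    assume "AE x in M. x \<in> A"
    then have "expectation (\<lambda>_. \<mu> + \<epsilon>) \<le> expectation (\<lambda>x. \<Sum>i\<in>I. X i x)"
      using int_X by (intro integral_mono_AE) (auto simp: A_def)
    then show False
      using int_X assms by (simp add: \<mu>_def prob_space)
  qed
  have "exp (l * \<epsilon>) * prob A = expectation (\<lambda>x. exp (l * \<epsilon>) * indicator A x)"
    by simp
  \<comment> \<open>Markov's inequality, made strict: off \<open>A\<close> the left integrand is 0
    and the right one a positive exponential, and the complement of \<open>A\<close> has positive
    measure.\<close>
  also have "\<dots> < expectation (\<lambda>x. \<Prod>i\<in>I. Y i x)"
  proof (rule integral_less_AE[where A = "space M - A"])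
    show "emeasure M (space M - A) \<noteq> 0"
      using not_AE AE_iff_measurable[of "space M - A" M "\<lambda>x. x \<in> A"] by auto
    show "AE x in M. exp (l * \<epsilon>) * indicator A x \<le> (\<Prod>i\<in>I. Y i x)"
      unfolding prod_Y using l by (auto simp: A_def indicator_def)
  qed (use int_Y A in \<open>auto simp: prod_Y emeasure_eq_measure\<close>)
  also have "\<dots> = (\<Prod>i\<in>I. expectation (Y i))"
    using Y by (intro indep_vars_lebesgue_integral fin indep_Y) auto
  also have "\<dots> \<le> (\<Prod>i\<in>I. exp (l\<^sup>2 * (b i - a i)\<^sup>2 / 8))"
    using Y by (intro prod_mono) (auto simp: Y_def intro!: integral_nonneg_AE)
  also have "\<dots> = exp (l\<^sup>2 * D / 8)"
    by (simp add: D_def fin sum_distrib_left sum_divide_distrib flip: exp_sum)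
  finally have "prob A < exp (l\<^sup>2 * D / 8) / exp (l * \<epsilon>)"
    by (simp add: field_simps)
  also have "\<dots> = exp (l\<^sup>2 * D / 8 - l * \<epsilon>)"
    by (simp add: exp_diff)
  also have "l\<^sup>2 * D / 8 - l * \<epsilon> = -2 * \<epsilon>\<^sup>2 / D"
    using D by (simp add: l_def field_simps power2_eq_square)
  finally show ?thesis
    by (simp add: A_def D_def)
qed

text \<open>Strictness in one of the two tails makes the sum strict, so the ordinary bound is enough
  for the lower tail.\<close>

lemma (in Hoeffding_ineq) Hoeffding_ineq_abs_ge_strict:
  assumes "\<epsilon> > 0" and "(\<Sum>i\<in>I. (b i - a i)\<^sup>2) > 0"
  shows "prob {x\<in>space M. \<bar>(\<Sum>i\<in>I. X i x) - \<mu>\<bar> \<ge> \<epsilon>}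
    < 2 * exp (-2 * \<epsilon>\<^sup>2 / (\<Sum>i\<in>I. (b i - a i)\<^sup>2))"
proof -
  have "{x\<in>space M. \<bar>(\<Sum>i\<in>I. X i x) - \<mu>\<bar> \<ge> \<epsilon>} =
      {x\<in>space M. (\<Sum>i\<in>I. X i x) \<ge> \<mu> + \<epsilon>} \<union> {x\<in>space M. (\<Sum>i\<in>I. X i x) \<le> \<mu> - \<epsilon>}"
    by auto
  also have "prob \<dots> \<le> prob {x\<in>space M. (\<Sum>i\<in>I. X i x) \<ge> \<mu> + \<epsilon>} +
      prob {x\<in>space M. (\<Sum>i\<in>I. X i x) \<le> \<mu> - \<epsilon>}"
    by (intro measure_Un_le) auto
  also have "\<dots> < exp (-2 * \<epsilon>\<^sup>2 / (\<Sum>i\<in>I. (b i - a i)\<^sup>2)) + exp (-2 * \<epsilon>\<^sup>2 / (\<Sum>i\<in>I. (b i - a i)\<^sup>2))"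
    using assms
    by (intro add_less_le_mono Hoeffding_ineq_ge_strict Hoeffding_ineq_le) auto
  finally show ?thesis by simp
qed

section \<open>The Monte Carlo estimator\<close>

lemma mc_shapley_tail:
  assumes iid: "iid_uniform_perms P N n X" and "n \<ge> 1"
    and bound: "\<And>\<pi>. \<bar>marginal N v \<pi> i\<bar> \<le> r"
    and "\<epsilon> > 0" "0 < \<delta>" "real n \<ge> 2 * r\<^sup>2 / \<epsilon>\<^sup>2 * ln (2 / \<delta>)"
  shows "\<P>(\<omega> in P. \<bar>mc_shapley N v n (\<lambda>s. X s \<omega>) i - shapley N v i\<bar> \<ge> \<epsilon>) < \<delta>"
\<comment> \<open>For \<open>r = 0\<close> the denominator in Hoeffding's exponent vanishes. But
  then estimate and Shapley value are both 0, and the event is empty.\<close>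
proof (cases "r = 0")
  case True
  then have "marginal N v \<pi> i = 0" for \<pi>
    using bound by simp
  then have "mc_shapley N v n \<sigma> i = 0" "shapley N v i = 0" for \<sigma>
    by (simp_all add: mc_shapley_def shapley_def)
  then show ?thesis using assms by simp
next
  case False
  have r: "r > 0" using False bound[of id] by linarith
  interpret prob_space P using iid by (simp add: iid_uniform_perms_def)
  define Y where "Y = (\<lambda>s \<omega>. marginal N v (X s \<omega>) i)"
  have indep_X: "indep_vars (\<lambda>_. count_space UNIV) X {1..n}"
    and distr_X: "\<And>s. s \<in> {1..n} \<Longrightarrow> distr P (count_space UNIV) (X s) =
        measure_pmf (pmf_of_set {\<pi>. \<pi> permutes {1..N}})"
    using iid by (auto simp: iid_uniform_perms_def)
  have X [measurable]: "X s \<in> P \<rightarrow>\<^sub>M count_space UNIV" if "s \<in> {1..n}" for s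
    using indep_X that by (auto simp: indep_vars_def)
  have indep_Y: "indep_vars (\<lambda>_. borel) Y {1..n}"
    unfolding Y_def by (rule indep_vars_compose2[OF indep_X]) simp
  \<comment> \<open>The estimator is unbiased: the mean under the uniform distribution is the
    average over all \<open>fact N\<close> permutations.\<close>
  have E_Y: "expectation (Y s) = shapley N v i" if "s \<in> {1..n}" for s
  proof -
    have "id \<in> {\<pi>. \<pi> permutes {1..N}}" by (simp add: permutes_id)
    then have ne: "{\<pi>. \<pi> permutes {1..N}} \<noteq> {}" by blast
    have "expectation (Y s) =
        integral\<^sup>L (distr P (count_space UNIV) (X s)) (\<lambda>\<pi>. marginal N v \<pi> i)"
      unfolding Y_def using that by (subst integral_distr) auto
    also have "\<dots> = shapley N v i"
      using that ne
      by (simp add: distr_X integral_pmf_of_set finite_permutations card_permutations[of _ N]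
          shapley_def)
    finally show ?thesis .
  qed
  interpret H: Hoeffding_ineq P "{1..n}" Y "\<lambda>_. -r" "\<lambda>_. r" "\<Sum>s\<in>{1..n}. expectation (Y s)"
    using bound indep_Y by unfold_locales (auto simp: Y_def abs_le_iff minus_le_iff)
  have sum: "(\<Sum>s\<in>{1..n}. expectation (Y s)) = real n * shapley N v i"
    using E_Y by simp
  have "\<bar>mc_shapley N v n (\<lambda>s. X s \<omega>) i - shapley N v i\<bar> \<ge> \<epsilon> \<longleftrightarrow>
      \<bar>(\<Sum>s\<in>{1..n}. Y s \<omega>) - real n * shapley N v i\<bar> \<ge> real n * \<epsilon>" for \<omega>
  proof -
    have "(\<Sum>s\<in>{1..n}. Y s \<omega>) - real n * shapley N v i =
        real n * (mc_shapley N v n (\<lambda>s. X s \<omega>) i - shapley N v i)"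
      using \<open>n \<ge> 1\<close> by (simp add: mc_shapley_def Y_def field_simps)
    then show ?thesis
      using \<open>n \<ge> 1\<close> by (simp add: abs_mult)
  qed
  then have "\<P>(\<omega> in P. \<bar>mc_shapley N v n (\<lambda>s. X s \<omega>) i - shapley N v i\<bar> \<ge> \<epsilon>) =
      \<P>(\<omega> in P. \<bar>(\<Sum>s\<in>{1..n}. Y s \<omega>) - (\<Sum>s\<in>{1..n}. expectation (Y s))\<bar> \<ge> real n * \<epsilon>)"
    by (simp only: sum)
  also have "\<dots> < 2 * exp (-2 * (real n * \<epsilon>)\<^sup>2 / (\<Sum>s\<in>{1..n}. (r - - r)\<^sup>2))"
    using assms r by (intro H.Hoeffding_ineq_abs_ge_strict) auto
  \<comment> \<open>The \<open>n\<close> intervals of length \<open>2 * r\<close> give the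
    denominator \<open>4 * n * r\<^sup>2\<close>. The assumed sample size says exactly that the
    resulting exponent is at most \<open>- ln (2 / \<delta>)\<close>.\<close>
  also have "-2 * (real n * \<epsilon>)\<^sup>2 / (\<Sum>s\<in>{1..n}. (r - - r)\<^sup>2) = - (real n * (\<epsilon>\<^sup>2 / (2 * r\<^sup>2)))"
    using \<open>n \<ge> 1\<close> r by (simp add: field_simps power2_eq_square)
  also have "2 * exp \<dots> \<le> 2 * exp (- ln (2 / \<delta>))"
    using assms r by (simp add: field_simps)
  also have "\<dots> = \<delta>"
    using assms by (simp add: exp_minus)
  finally show ?thesis .
qed

text \<open>Once \<open>N' / \<delta>\<close> is at least 2, the summand \<open>ln 2\<close> in
  \<open>ln (2 * N' / \<delta>)\<close> is at most \<open>ln (N' / \<delta>)\<close>, so the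
  logarithm at most doubles. With the leading factor 2 this gives the constant 4.\<close>

lemma sample_size_bigo:
  "(\<lambda>(r, \<epsilon>, \<delta>, N'). 2 * r\<^sup>2 / \<epsilon>\<^sup>2 * ln (2 * real N' / \<delta>))
     \<in> O[sample_regime](\<lambda>(r, \<epsilon>, \<delta>, N'). r\<^sup>2 / \<epsilon>\<^sup>2 * ln (real N' / \<delta>))"
proof (rule bigoI[where c = 4])
  have "2 * r\<^sup>2 / \<epsilon>\<^sup>2 * ln (2 * real N / \<delta>) \<le> 4 * (r\<^sup>2 / \<epsilon>\<^sup>2 * ln (real N / \<delta>)) \<and>
      0 \<le> 2 * r\<^sup>2 / \<epsilon>\<^sup>2 * ln (2 * real N / \<delta>)"
    if "real N / \<delta> \<ge> 2" for r \<epsilon> \<delta> :: real and N :: nat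
  proof -
    have "ln (2 * q) = ln 2 + ln q" if "q \<ge> 2" for q :: real
      using that by (subst ln_mult) auto
    from this[OF that] have "ln (2 * (real N / \<delta>)) = ln 2 + ln (real N / \<delta>)" .
    moreover have "ln 2 \<le> ln (real N / \<delta>)"
      using that by (intro ln_mono) auto
    moreover have "ln 2 \<ge> (0 :: real)" by simp
    ultimately have "ln (2 * real N / \<delta>) \<le> 2 * ln (real N / \<delta>)" "0 \<le> ln (2 * real N / \<delta>)"
      unfolding times_divide_eq_right by linarith+
    then show ?thesis
      using mult_left_mono[of "ln (2 * real N / \<delta>)" "2 * ln (real N / \<delta>)" "2 * r\<^sup>2 / \<epsilon>\<^sup>2"]
      by simp
  qed
  then show "\<forall>\<^sub>F x in sample_regime.
      norm (case x of (r, \<epsilon>, \<delta>, N') \<Rightarrow> 2 * r\<^sup>2 / \<epsilon>\<^sup>2 * ln (2 * real N' / \<delta>))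
      \<le> 4 * norm (case x of (r, \<epsilon>, \<delta>, N') \<Rightarrow> r\<^sup>2 / \<epsilon>\<^sup>2 * ln (real N' / \<delta>))"
    unfolding sample_regime_def eventually_inf_principal eventually_filtercomap_at_top_linorder
    by (intro exI[of _ 2]) (force simp: abs_mult)
qed

theorem theorem5p7:
  fixes N K n :: nat and b d :: "nat \<Rightarrow> real" and M :: "real set"
    and f :: "(nat \<times> real \<Rightarrow> real) \<Rightarrow> real" and L :: real
    and P :: "'a measure" and X :: "nat \<Rightarrow> 'a \<Rightarrow> nat \<Rightarrow> nat"
    and v :: "nat set \<Rightarrow> real" and R :: "nat \<Rightarrow> real" and Rmax :: real
  assumes "persistence_diagram N b d"
    and "K \<ge> 1" and "finite M"
    and "lipschitz1 K M L f"
    and "n \<ge> 1"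
    and "iid_uniform_perms P N n X"
  defines "v \<equiv> landscape_game b d K M f"
    and "R \<equiv> (\<lambda>i. L * tent_norm1 b d M i)"
    and "Rmax \<equiv> Max (R ` {1..N})"
  shows "(\<forall>i\<in>{1..N}. \<forall>\<epsilon>>0. \<forall>\<delta>\<in>{0<..<1}.
            real n \<ge> 2 * (R i)\<^sup>2 / \<epsilon>\<^sup>2 * ln (2 / \<delta>) \<longrightarrow>
            \<P>(\<omega> in P. \<bar>mc_shapley N v n (\<lambda>s. X s \<omega>) i - shapley N v i\<bar> \<ge> \<epsilon>) < \<delta>) \<and>
         (\<forall>\<epsilon>>0. \<forall>\<delta>\<in>{0<..<1}.
            real n \<ge> 2 * Rmax\<^sup>2 / \<epsilon>\<^sup>2 * ln (2 * real N / \<delta>) \<longrightarrow>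
            \<P>(\<omega> in P. \<exists>i\<in>{1..N}.
                \<bar>mc_shapley N v n (\<lambda>s. X s \<omega>) i - shapley N v i\<bar> \<ge> \<epsilon>) < \<delta>) \<and>
         (\<lambda>(r, \<epsilon>, \<delta>, N'). 2 * r\<^sup>2 / \<epsilon>\<^sup>2 * ln (2 * real N' / \<delta>))
            \<in> O[sample_regime](\<lambda>(r, \<epsilon>, \<delta>, N'). r\<^sup>2 / \<epsilon>\<^sup>2 * ln (real N' / \<delta>))"
proof (intro conjI ballI allI impI)
  have bound: "\<bar>marginal N v \<pi> i\<bar> \<le> R i" for \<pi> i
    unfolding v_def R_def using assms by (intro abs_marginal_landscape_game_le) auto
  have N: "N \<ge> 1" using assms by (simp add: persistence_diagram_def)
  {
    fix i and \<epsilon> \<delta> :: real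
    assume "\<epsilon> > 0" "\<delta> \<in> {0<..<1}" "real n \<ge> 2 * (R i)\<^sup>2 / \<epsilon>\<^sup>2 * ln (2 / \<delta>)"
    then show "\<P>(\<omega> in P. \<bar>mc_shapley N v n (\<lambda>s. X s \<omega>) i - shapley N v i\<bar> \<ge> \<epsilon>) < \<delta>"
      using assms bound by (intro mc_shapley_tail) auto
  }
  fix \<epsilon> \<delta> :: real
  assume \<epsilon>: "\<epsilon> > 0" and \<delta>: "\<delta> \<in> {0<..<1}"
    and n: "real n \<ge> 2 * Rmax\<^sup>2 / \<epsilon>\<^sup>2 * ln (2 * real N / \<delta>)"
  interpret prob_space P using assms by (simp add: iid_uniform_perms_def)
  let ?B = "\<lambda>i. {\<omega> \<in> space P. \<bar>mc_shapley N v n (\<lambda>s. X s \<omega>) i - shapley N v i\<bar> \<ge> \<epsilon>}"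
  have X: "X s \<in> P \<rightarrow>\<^sub>M count_space UNIV" if "s \<in> {1..n}" for s
    using assms that by (auto simp: iid_uniform_perms_def indep_vars_def)
  have [measurable]: "(\<lambda>\<omega>. marginal N v (X s \<omega>) i) \<in> borel_measurable P"
    if "s \<in> {1..n}" for s i
    by (rule measurable_compose[OF X[OF that]]) simp
  have events: "?B i \<in> events" for i
    unfolding mc_shapley_def by measurable
  \<comment> \<open>Each player gets the share \<open>\<delta> / N\<close> of the failure
    probability, which turns \<open>ln (2 / \<delta>)\<close> into
    \<open>ln (2 * N / \<delta>)\<close>.\<close>
  have tail: "prob (?B i) < \<delta> / N" if i: "i \<in> {1..N}" for i
  proof (rule mc_shapley_tail)
    have "0 \<le> R i" using bound[of id i] by linarith
    moreover have "R i \<le> Rmax" unfolding Rmax_def using i by (intro Max_ge) auto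
    ultimately have "(R i)\<^sup>2 \<le> Rmax\<^sup>2" by (intro power_mono)
    \<comment> \<open>The logarithm has to be nonnegative for the required sample size to grow when
      \<open>R i\<close> is replaced by \<open>Rmax\<close>.\<close>
    moreover have "2 * real N / \<delta> \<ge> 1" using \<delta> N by (simp add: field_simps)
    then have "ln (2 * real N / \<delta>) \<ge> 0" by simp
    ultimately have "2 * (R i)\<^sup>2 / \<epsilon>\<^sup>2 * ln (2 * real N / \<delta>)
        \<le> 2 * Rmax\<^sup>2 / \<epsilon>\<^sup>2 * ln (2 * real N / \<delta>)"
      by (intro mult_right_mono divide_right_mono) auto
    with n show "real n \<ge> 2 * (R i)\<^sup>2 / \<epsilon>\<^sup>2 * ln (2 / (\<delta> / N))" by simp
  qed (use assms bound \<epsilon> \<delta> N in auto)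
  have "\<P>(\<omega> in P. \<exists>i\<in>{1..N}. \<bar>mc_shapley N v n (\<lambda>s. X s \<omega>) i - shapley N v i\<bar> \<ge> \<epsilon>)
      = prob (\<Union>i\<in>{1..N}. ?B i)"
    by (intro arg_cong[where f = prob]) auto
  also have "\<dots> \<le> (\<Sum>i\<in>{1..N}. prob (?B i))"
    using events by (intro finite_measure_subadditive_finite) auto
  \<comment> \<open>The strict individual bounds survive the summation because there is at least one
    player.\<close>
  also have "\<dots> < (\<Sum>i\<in>{1..N}. \<delta> / N)"
    using N tail by (intro sum_strict_mono) auto
  also have "\<dots> = \<delta>" using N by simp
  finally show "\<P>(\<omega> in P. \<exists>i\<in>{1..N}.
      \<bar>mc_shapley N v n (\<lambda>s. X s \<omega>) i - shapley N v i\<bar> \<ge> \<epsilon>) < \<delta>" .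
qed (rule sample_size_bigo)

end
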